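(* Let $M$ be a simple matroid, let $k\ge 1$, and let $(X_1,\dots,X_k)\in\mathcal{F}l^k_M$. Then $$\mathrm{sgn}\bigl(\mu^k(X_1,\dots,X_k)\bigr)=\prod_{i=1}^k(-1)^{\mathrm{rk}(X_i)}.$$
   Context: A matroid $M=(\mathcal{A},\mathrm{rk})$ is given by a finite ground set $\mathcal{A}$ and its rank function; it is simple if it has no loops and no parallel elements. $L(M)$ is its lattice of flats, and for $S\subseteq\mathcal{A}$, $\vee S$ denotes the smallest flat containing $S$ (the closure of $S$). For $k\ge1$ let $\mathcal{F}l^k_M=\{(X_1,\dots,X_k)\in L(M)^k\mid X_1\subseteq X_2\subseteq\cdots\subseteq X_k\}$ and $\mathcal{C}^k_{\mathcal{A}}=\{(A_1,\dots,A_k)\in(2^{\mathcal{A}})^k\mid A_1\subseteq\cdots\subseteq A_k\subseteq\mathcal{A}\}$ (inclusions need not be strict). The $k$th chain Möbius function $\mu^k:\mathcal{F}l^k_M\to\mathbb{Z}$ is $$\mu^k(X_1,\dots,X_k)=\sum_{\substack{(A_i)\in\mathcal{C}^k_{\mathcal{A}}\\ \vee A_i=X_i\ \text{for all } i}}\ \prod_{i=1}^k(-1)^{|A_i|}.$$ Here $\mathrm{sgn}(m)\in\{-1,0,1\}$ is the sign of the integer $m$. *)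

theory Defs
  imports Main
begin

text \<open>Matroids on a finite ground set \<open>E\<close>, given by the standard rank axioms. The values of
  \<open>rk\<close> on sets that are not contained in \<open>E\<close> are irrelevant.\<close>

locale matroid =
  fixes E :: "'a set" and rk :: "'a set \<Rightarrow> nat"
  assumes finite_ground: "finite E"
    and rk_le_card: "S \<subseteq> E \<Longrightarrow> rk S \<le> card S"
    and rk_mono: "S \<subseteq> T \<Longrightarrow> T \<subseteq> E \<Longrightarrow> rk S \<le> rk T"
    and rk_submodular:
      "S \<subseteq> E \<Longrightarrow> T \<subseteq> E \<Longrightarrow> rk (S \<union> T) + rk (S \<inter> T) \<le> rk S + rk T"
begin

definition loop :: "'a \<Rightarrow> bool" where
  "loop e \<longleftrightarrow> e \<in> E \<and> rk {e} = 0"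

definition parallel :: "'a \<Rightarrow> 'a \<Rightarrow> bool" where
  "parallel e f \<longleftrightarrow>
     e \<in> E \<and> f \<in> E \<and> e \<noteq> f \<and> \<not> loop e \<and> \<not> loop f \<and> rk {e, f} = 1"

definition flats :: "'a set set" where
  "flats = {F. F \<subseteq> E \<and> (\<forall>e \<in> E - F. rk F < rk (insert e F))}"

text \<open>The smallest flat (with respect to inclusion) containing \<open>S\<close>; it exists for every
  \<open>S \<subseteq> E\<close>, see the lemmas \<open>closure_flat\<close>, \<open>closure_superset\<close> and \<open>closure_least\<close> below.\<close>

definition closure :: "'a set \<Rightarrow> 'a set" where
  "closure S = (LEAST F. F \<in> flats \<and> S \<subseteq> F)"

text \<open>A tuple \<open>(X\<^sub>1, \<dots>, X\<^sub>k)\<close> is encoded as a list \<open>Xs\<close> of length \<open>k\<close>, so that \<open>X\<^sub>i\<close>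
  is \<open>Xs ! (i - 1)\<close> and indices run over \<open>0, \<dots>, k - 1\<close>.\<close>

definition flat_chains :: "nat \<Rightarrow> 'a set list set" where
  "flat_chains k = {Xs. length Xs = k \<and> set Xs \<subseteq> flats \<and> sorted_wrt (\<subseteq>) Xs}"

definition subset_chains :: "nat \<Rightarrow> 'a set list set" where
  "subset_chains k = {As. length As = k \<and> set As \<subseteq> Pow E \<and> sorted_wrt (\<subseteq>) As}"

definition chain_mobius :: "nat \<Rightarrow> 'a set list \<Rightarrow> int" where
  "chain_mobius k Xs =
     (\<Sum>As \<in> {As \<in> subset_chains k. \<forall>i<k. closure (As ! i) = Xs ! i}.
        \<Prod>i<k. (-1) ^ card (As ! i))"

lemma flats_Int:
  assumes F: "F \<in> flats" and G: "G \<in> flats"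
  shows "F \<inter> G \<in> flats"
proof -
  have FE: "F \<subseteq> E" and GE: "G \<subseteq> E"
    using F G by (auto simp: flats_def)
  have extend: "rk (F \<inter> G) < rk (insert e (F \<inter> G))"
    if H: "H \<in> flats" "F \<inter> G \<subseteq> H" and e: "e \<in> E - H" for e H
  proof -
    have HE: "H \<subseteq> E" and lt: "rk H < rk (insert e H)"
      using H e by (auto simp: flats_def)
    have "rk (H \<union> insert e (F \<inter> G)) + rk (H \<inter> insert e (F \<inter> G))
            \<le> rk H + rk (insert e (F \<inter> G))"
      using FE HE e by (intro rk_submodular) auto
    moreover have "H \<union> insert e (F \<inter> G) = insert e H" "H \<inter> insert e (F \<inter> G) = F \<inter> G"
      using H e by auto
    ultimately show ?thesis using lt by simp
  qed
  have "rk (F \<inter> G) < rk (insert e (F \<inter> G))" if "e \<in> E - F \<inter> G" for e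
    using that extend[OF F] extend[OF G] by blast
  then show ?thesis using FE by (auto simp: flats_def)
qed

lemma least_flat_exists:
  assumes "S \<subseteq> E"
  shows "\<exists>F. F \<in> flats \<and> S \<subseteq> F \<and> (\<forall>G. G \<in> flats \<and> S \<subseteq> G \<longrightarrow> F \<subseteq> G)"
proof -
  let ?P = "\<lambda>F. F \<in> flats \<and> S \<subseteq> F"
  have "?P E" using assms by (auto simp: flats_def)
  then obtain F where F: "?P F" and min: "\<And>G. ?P G \<Longrightarrow> card F \<le> card G"
    using ex_has_least_nat[of ?P E card] by blast
  have "F \<subseteq> G" if "?P G" for G
  proof -
    have "finite F" using F finite_ground by (auto simp: flats_def intro: finite_subset)
    moreover have "card F \<le> card (F \<inter> G)"
      using F that flats_Int by (intro min) auto
    ultimately have "F \<inter> G = F" by (intro card_seteq) auto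
    then show ?thesis by blast
  qed
  then show ?thesis using F by blast
qed

lemma
  assumes "S \<subseteq> E"
  shows closure_flat: "closure S \<in> flats"
    and closure_superset: "S \<subseteq> closure S"
    and closure_least: "\<And>G. G \<in> flats \<Longrightarrow> S \<subseteq> G \<Longrightarrow> closure S \<subseteq> G"
proof -
  obtain F where F: "F \<in> flats" "S \<subseteq> F" "\<And>G. G \<in> flats \<Longrightarrow> S \<subseteq> G \<Longrightarrow> F \<subseteq> G"
    using least_flat_exists[OF assms] by blast
  have eq: "closure S = F"
    unfolding closure_def by (rule Least_equality) (use F in auto)
  show "closure S \<in> flats" "S \<subseteq> closure S"
    and "\<And>G. G \<in> flats \<Longrightarrow> S \<subseteq> G \<Longrightarrow> closure S \<subseteq> G"
    unfolding eq using F by auto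
qed

end

locale simple_matroid = matroid +
  assumes no_loops: "\<not> loop e"
    and no_parallel: "\<not> parallel e f"

end

theory Submission imports Defs begin

text \<open>
  For \<open>A \<subseteq> X\<close> let \<open>h(A, X)\<close> be the sum of \<open>(-1)\<^bsup>|B|\<^esup>\<close> over the spanning sets \<open>B\<close> of \<open>X\<close> that contain \<open>A\<close>.
  If the contraction of \<open>X\<close> by \<open>A\<close> has a loop \<open>e\<close>, then toggling \<open>e\<close> shows \<open>h(A, X) = 0\<close>;
  otherwise deletion and contraction of one element show that \<open>h(A, X)\<close> has sign
  \<open>(-1)\<^bsup>|A| + rk X - rk A\<^esup>\<close>. In a chain \<open>A\<^sub>1 \<subseteq> \<dots> \<subseteq> A\<^sub>k\<close>, the sum over \<open>A\<^sub>k\<close> is \<open>h(A\<^sub>k\<^sub>-\<^sub>1, X\<^sub>k)\<close>,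
  which vanishes unless \<open>A\<^sub>k\<^sub>-\<^sub>1 = X\<^sub>k\<^sub>-\<^sub>1\<close>. Hence
  \<open>\<mu>\<^sup>k(X\<^sub>1, \<dots>, X\<^sub>k) = \<mu>\<^sup>k\<^sup>-\<^sup>2(X\<^sub>1, \<dots>, X\<^sub>k\<^sub>-\<^sub>2) (-1)\<^bsup>|X\<^sub>k\<^sub>-\<^sub>1|\<^esup> h(X\<^sub>k\<^sub>-\<^sub>1, X\<^sub>k)\<close>,
  and the claim follows by induction in steps of two.
\<close>

section \<open>Signs of integers\<close>

lemma sgn_minus_one_power: "sgn ((-1) ^ n :: int) = (-1) ^ n"
  by (cases "even n") auto

text \<open>Serves deletion-contraction, where the contraction term \<open>a\<close> may vanish but
  never has the opposite sign, so nothing cancels.\<close>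

lemma sgn_add_eq_power:
  fixes a b :: int
  assumes "sgn a = 0 \<or> sgn a = (-1) ^ n" and "sgn b = (-1) ^ n"
  shows "sgn (a + b) = (-1) ^ n"
  using assms by (cases "even n") (auto simp: sgn_if split: if_splits)

context matroid
begin

section \<open>Rank and closure\<close>

lemma rk_empty: "rk {} = 0"
  using rk_le_card[of "{}"] by simp

lemma rk_insert_le:
  assumes "S \<subseteq> E" and "e \<in> E"
  shows "rk (insert e S) \<le> rk S + 1"
proof (cases "e \<in> S")
  case False
  then have "rk (insert e S) + rk {} \<le> rk S + rk {e}"
    using rk_submodular[of S "{e}"] assms by simp
  moreover have "rk {e} \<le> 1"
    using rk_le_card[of "{e}"] assms by simp
  ultimately show ?thesis by simp
qed (simp add: insert_absorb)

text \<open>Submodularity for \<open>B\<close> and \<open>insert e A\<close>, which meet in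
  \<open>A\<close> when \<open>e \<notin> B\<close>.\<close>

lemma rk_insert_superset:
  assumes "A \<subseteq> B" and "B \<subseteq> E" and "e \<in> E" and "rk (insert e A) = rk A"
  shows "rk (insert e B) = rk B"
proof (cases "e \<in> B")
  case False
  have "rk (B \<union> insert e A) + rk (B \<inter> insert e A) \<le> rk B + rk (insert e A)"
    using assms by (intro rk_submodular) auto
  moreover have "B \<union> insert e A = insert e B" "B \<inter> insert e A = A"
    using assms(1) False by auto
  ultimately have "rk (insert e B) \<le> rk B"
    using assms(4) by simp
  moreover have "rk B \<le> rk (insert e B)"
    using assms by (intro rk_mono) auto
  ultimately show ?thesis by simp
qed (simp add: insert_absorb)

lemma rk_Un_eq:
  assumes "B \<subseteq> E" and "finite C" and "C \<subseteq> {e \<in> E. rk (insert e B) = rk B}"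
  shows "rk (B \<union> C) = rk B"
  using assms(2,3)
proof (induction C)
  case (insert e C)
  then have "rk (insert e (B \<union> C)) = rk (B \<union> C)"
    using assms(1) by - (rule rk_insert_superset[of B], auto)
  with insert show ?case by simp
qed simp

text \<open>The set \<open>?F\<close> of all elements that add no rank to \<open>B\<close> is a flat
  of rank \<open>rk B\<close>, so \<open>closure B\<close> is caught between \<open>B\<close> and
  \<open>?F\<close>.\<close>

lemma rk_closure:
  assumes "B \<subseteq> E"
  shows "rk (closure B) = rk B"
proof -
  let ?F = "{e \<in> E. rk (insert e B) = rk B}"
  have sub: "B \<subseteq> ?F"
    using assms by (auto simp: insert_absorb)
  have "rk (B \<union> ?F) = rk B"
    using finite_ground by (intro rk_Un_eq[OF assms]) auto
  then have rkF: "rk ?F = rk B"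
    using sub by (simp add: Un_absorb1)
  have "rk ?F < rk (insert e ?F)" if e: "e \<in> E - ?F" for e
  proof -
    have "rk B \<le> rk (insert e B)"
      using e assms by (intro rk_mono) auto
    then have "rk B < rk (insert e B)"
      using e by auto
    also have "\<dots> \<le> rk (insert e ?F)"
      using e sub by (intro rk_mono) auto
    finally show ?thesis
      using rkF by simp
  qed
  then have "?F \<in> flats"
    by (auto simp: flats_def)
  then have "closure B \<subseteq> ?F"
    using closure_least[OF assms] sub by blast
  then have "rk (closure B) \<le> rk B"
    using rk_mono[of "closure B" ?F] rkF by auto
  moreover have "rk B \<le> rk (closure B)"
    using closure_superset[OF assms] closure_flat[OF assms]
    by (intro rk_mono) (auto simp: flats_def)
  ultimately show ?thesis by simp
qed

text \<open>Trades the closure condition in the sum for a rank condition. From right to left,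
  \<open>closure B\<close> is a flat inside \<open>X\<close> of the same rank, and a flat cannot
  grow without gaining rank.\<close>

lemma closure_eq_flat_iff:
  assumes X: "X \<in> flats" and B: "B \<subseteq> E"
  shows "closure B = X \<longleftrightarrow> B \<subseteq> X \<and> rk B = rk X"
proof
  assume "closure B = X"
  then show "B \<subseteq> X \<and> rk B = rk X"
    using rk_closure[OF B] closure_superset[OF B] by auto
next
  assume sp: "B \<subseteq> X \<and> rk B = rk X"
  have XE: "X \<subseteq> E"
    using X by (auto simp: flats_def)
  have sub: "closure B \<subseteq> X"
    using closure_least[OF B X] sp by blast
  have "e \<in> closure B" if e: "e \<in> X" for e
  proof (rule ccontr)
    assume "e \<notin> closure B"
    then have "rk (closure B) < rk (insert e (closure B))"
      using closure_flat[OF B] e XE by (auto simp: flats_def)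
    also have "\<dots> \<le> rk X"
      using sub e XE by (intro rk_mono) auto
    finally show False
      using rk_closure[OF B] sp by simp
  qed
  with sub show "closure B = X" by blast
qed

section \<open>Alternating sums over spanning sets\<close>

definition spanning_sum :: "'a set \<Rightarrow> 'a set \<Rightarrow> int" where
  "spanning_sum A X = (\<Sum>B \<in> {B. A \<subseteq> B \<and> B \<subseteq> X \<and> rk B = rk X}. (-1) ^ card B)"

text \<open>Sorts the spanning sets by whether they contain \<open>e\<close>. For
  \<open>A \<subseteq> X\<close> the sum is, up to sign, the Tutte value T(1, 0) of the contraction
  of \<open>X\<close> by \<open>A\<close>, and this is its deletion-contraction rule: the last sum
  is \<open>spanning_sum A (X - {e})\<close> if deleting \<open>e\<close> keeps the rank, and empty
  otherwise.\<close>

lemma spanning_sum_split: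
  assumes "X \<subseteq> E" and "e \<in> X"
  shows "spanning_sum A X = spanning_sum (insert e A) X
           + (\<Sum>B \<in> {B. A \<subseteq> B \<and> B \<subseteq> X - {e} \<and> rk B = rk X}. (-1) ^ card B)"
proof -
  have finP: "finite (Pow X)"
    using finite_subset[OF assms(1) finite_ground] by simp
  have fin': "finite {B. A' \<subseteq> B \<and> B \<subseteq> X \<and> rk B = rk X}" for A'
    by (rule finite_subset[OF _ finP]) auto
  have fin'': "finite {B. A \<subseteq> B \<and> B \<subseteq> X - {e} \<and> rk B = rk X}"
    by (rule finite_subset[OF _ finP]) auto
  have "{B. A \<subseteq> B \<and> B \<subseteq> X \<and> rk B = rk X} =
      {B. insert e A \<subseteq> B \<and> B \<subseteq> X \<and> rk B = rk X} \<union> {B. A \<subseteq> B \<and> B \<subseteq> X - {e} \<and> rk B = rk X}"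
    by auto
  then show ?thesis
    unfolding spanning_sum_def
    by (simp only:) (rule sum.union_disjoint[OF fin' fin''], auto)
qed

lemma spanning_sum_eq_0:
  assumes X: "X \<subseteq> E" and e: "e \<in> X - A" and loop: "rk (insert e A) = rk A"
  shows "spanning_sum A X = 0"
proof -
  let ?D = "{B. A \<subseteq> B \<and> B \<subseteq> X - {e} \<and> rk B = rk X}"
  let ?C = "{B. insert e A \<subseteq> B \<and> B \<subseteq> X \<and> rk B = rk X}"
  have rk_toggle: "rk (insert e B) = rk B" if "A \<subseteq> B" "B \<subseteq> X" for B
    by (rule rk_insert_superset[of A]) (use that X e loop in auto)
  \<comment> \<open>Adding \<open>e\<close> maps the spanning sets without \<open>e\<close>
    bijectively onto those with \<open>e\<close> and flips each sign, so the two halves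
    cancel.\<close>
  have "?C = insert e ` ?D"
  proof (intro equalityI subsetI)
    fix B assume B: "B \<in> ?C"
    then have "insert e (B - {e}) = B" "A \<subseteq> B - {e}"
      using e by auto
    moreover from this have "rk (B - {e}) = rk B"
      using rk_toggle[of "B - {e}"] B by fastforce
    ultimately show "B \<in> insert e ` ?D"
      using B by (intro image_eqI[of _ _ "B - {e}"]) auto
  next
    fix B assume "B \<in> insert e ` ?D"
    then obtain D where "D \<in> ?D" and "B = insert e D" by blast
    then show "B \<in> ?C"
      using rk_toggle[of D] e by auto
  qed
  moreover have "inj_on (insert e) ?D"
    by (auto simp: inj_on_def)
  ultimately have "spanning_sum (insert e A) X = (\<Sum>B\<in>?D. (-1) ^ card (insert e B))"
    unfolding spanning_sum_def by (simp add: sum.reindex)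
  also have "\<dots> = (\<Sum>B\<in>?D. - ((-1) ^ card B))"
  proof (rule sum.cong[OF refl])
    fix B assume "B \<in> ?D"
    then have "finite B" "e \<notin> B"
      using X finite_ground by (auto intro: finite_subset)
    then show "(-1) ^ card (insert e B) = - ((-1) ^ card B :: int)"
      by simp
  qed
  finally show ?thesis
    using spanning_sum_split[of X e A] X e by (simp add: sum_negf)
qed

text \<open>The third assumption says that the contraction of \<open>X\<close> by \<open>A\<close>
  has no loops. Writing \<open>rk A + rk X\<close> for \<open>rk X - rk A\<close> keeps the parity
  and avoids subtraction in \<open>nat\<close>. The induction varies both sets: contraction enlarges
  \<open>A\<close>, deletion shrinks \<open>X\<close>.\<close>

lemma sgn_spanning_sum:
  assumes "A \<subseteq> X" and "X \<subseteq> E" and "\<And>e. e \<in> X - A \<Longrightarrow> rk A < rk (insert e A)"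
  shows "sgn (spanning_sum A X) = (-1) ^ (card A + rk A + rk X)"
  using assms
proof (induction "card (X - A)" arbitrary: A X rule: less_induct)
  case less
  have fin: "finite X" "finite A"
    using less.prems finite_ground by (auto intro: finite_subset)
  show ?case
  proof (cases "X = A")
    case True
    then have "{B. A \<subseteq> B \<and> B \<subseteq> X \<and> rk B = rk X} = {A}"
      by auto
    with True show ?thesis
      by (simp add: spanning_sum_def sgn_minus_one_power uminus_power_if)
  next
    case False
    then obtain e where e: "e \<in> X" "e \<notin> A"
      using less.prems by blast
    have AE: "A \<subseteq> E" and eE: "e \<in> E"
      using less.prems e by auto
    have rke: "rk (insert e A) = rk A + 1"
      using less.prems(3)[of e] rk_insert_le[OF AE eE] e by simp
    let ?s = "(-1 :: int) ^ (card A + rk A + rk X)"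
    \<comment> \<open>Adding \<open>e\<close> raises \<open>card A\<close> and \<open>rk A\<close>
      by one each, so the parity of the exponent stays.\<close>
    have contract: "sgn (spanning_sum (insert e A) X) = ?s"
      if "\<And>f. f \<in> X - insert e A \<Longrightarrow> rk (insert e A) < rk (insert f (insert e A))"
    proof -
      have "card (X - insert e A) < card (X - A)"
        using fin e by (intro psubset_card_mono) auto
      then have "sgn (spanning_sum (insert e A) X)
          = (-1) ^ (card (insert e A) + rk (insert e A) + rk X)"
        using less.prems e that by (intro less.hyps) auto
      then show ?thesis
        using rke fin e by (simp add: power_add)
    qed
    show ?thesis
    proof (cases "rk (X - {e}) = rk X")
      case True
      \<comment> \<open>Contracting \<open>e\<close> may create loops, namely the elements parallel
        to \<open>e\<close> over \<open>A\<close>; then the term vanishes.\<close>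
      have "sgn (spanning_sum (insert e A) X) = 0 \<or> sgn (spanning_sum (insert e A) X) = ?s"
      proof (cases "\<exists>f. f \<in> X - insert e A \<and> rk (insert f (insert e A)) = rk (insert e A)")
        case True
        then show ?thesis
          using spanning_sum_eq_0[OF less.prems(2)] by auto
      next
        case False
        have "rk (insert e A) < rk (insert f (insert e A))" if "f \<in> X - insert e A" for f
        proof -
          have "rk (insert e A) \<le> rk (insert f (insert e A))"
            using that AE eE less.prems(2) by (intro rk_mono) auto
          then show ?thesis
            using False that by (metis le_neq_implies_less)
        qed
        then show ?thesis
          using contract by blast
      qed
      moreover have "sgn (spanning_sum A (X - {e})) = ?s"
      proof -
        have "card (X - {e} - A) < card (X - A)"
          using fin e by (intro psubset_card_mono) auto
        then have "sgn (spanning_sum A (X - {e})) = (-1) ^ (card A + rk A + rk (X - {e}))"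
          using less.prems e by (intro less.hyps) auto
        then show ?thesis
          using True by simp
      qed
      moreover have "spanning_sum A X = spanning_sum (insert e A) X + spanning_sum A (X - {e})"
        using spanning_sum_split[OF less.prems(2) e(1)] True
        by (simp add: spanning_sum_def)
      ultimately show ?thesis
        using sgn_add_eq_power by simp
    next
      case False
      \<comment> \<open>Here \<open>e\<close> is a coloop of \<open>X\<close>: every spanning set
        contains it, and only the contraction term remains.\<close>
      have lt: "rk (X - {e}) < rk X"
        using False rk_mono[of "X - {e}" X] less.prems(2) by auto
      have "rk B \<noteq> rk X" if "B \<subseteq> X - {e}" for B
        using that lt rk_mono[of B "X - {e}"] less.prems(2) by fastforce
      then have none: "{B. A \<subseteq> B \<and> B \<subseteq> X - {e} \<and> rk B = rk X} = {}"
        by blast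
      then have "spanning_sum A X = spanning_sum (insert e A) X"
        using spanning_sum_split[OF less.prems(2) e(1), of A] unfolding none by simp
      \<comment> \<open>Contracting a coloop creates no loop: otherwise \<open>e\<close> would add
        no rank to \<open>insert f A\<close>, hence none to the larger set
        \<open>X - {e}\<close>.\<close>
      moreover have "rk (insert e A) < rk (insert f (insert e A))" if f: "f \<in> X - insert e A" for f
      proof -
        have "rk (insert f A) \<noteq> rk (insert e (insert f A))"
        proof
          assume "rk (insert f A) = rk (insert e (insert f A))"
          then have "rk (insert e (X - {e})) = rk (X - {e})"
            using f e less.prems(1,2) by - (rule rk_insert_superset[of "insert f A"], auto)
          then show False
            using lt e by (simp add: insert_absorb)
        qed
        moreover have "rk (insert f A) \<le> rk (insert e (insert f A))"
          using f AE eE less.prems(2) by (intro rk_mono) auto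
        moreover have "rk A < rk (insert f A)"
          using f less.prems(3) by auto
        ultimately show ?thesis
          using rke by (simp add: insert_commute)
      qed
      ultimately show ?thesis
        using contract by simp
    qed
  qed
qed

text \<open>Contracting by a flat leaves no loops.\<close>

lemma sgn_spanning_sum_flat:
  assumes "Y \<in> flats" and "Z \<in> flats" and "Y \<subseteq> Z"
  shows "sgn (spanning_sum Y Z) = (-1) ^ (card Y + rk Y + rk Z)"
  using assms by (intro sgn_spanning_sum) (auto simp: flats_def)

section \<open>Summing out the last entries of a chain\<close>

definition spanning_chains :: "nat \<Rightarrow> 'a set list \<Rightarrow> 'a set list set" where
  "spanning_chains k Xs = {As \<in> subset_chains k. \<forall>i<k. closure (As ! i) = Xs ! i}"

definition chain_weight :: "'a set list \<Rightarrow> int" where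
  "chain_weight As = (\<Prod>i<length As. (-1) ^ card (As ! i))"

lemma chain_mobius_eq: "chain_mobius k Xs = (\<Sum>As \<in> spanning_chains k Xs. chain_weight As)"
  unfolding chain_mobius_def spanning_chains_def
  by (rule sum.cong) (auto simp: chain_weight_def subset_chains_def)

lemma chain_weight_snoc: "chain_weight (As @ [A]) = chain_weight As * (-1) ^ card A"
  by (simp add: chain_weight_def nth_append)

lemma finite_subset_chains: "finite (subset_chains k)"
proof (rule finite_subset)
  show "subset_chains k \<subseteq> {As. set As \<subseteq> Pow E \<and> length As = k}"
    by (auto simp: subset_chains_def)
  show "finite {As. set As \<subseteq> Pow E \<and> length As = k}"
    using finite_ground by (intro finite_lists_length_eq) simp
qed

text \<open>\<open>\<Union>(set As)\<close> is the last entry of the chain \<open>As\<close>, and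
  \<open>{}\<close> if \<open>As\<close> is empty, so the first entry of a chain needs no separate
  treatment.\<close>

lemma spanning_chains_snoc:
  assumes "length Xs = k" and "X \<in> flats"
  shows "spanning_chains (Suc k) (Xs @ [X]) =
    (\<lambda>(As, B). As @ [B]) `
      (SIGMA As : spanning_chains k Xs. {B. \<Union>(set As) \<subseteq> B \<and> B \<subseteq> X \<and> rk B = rk X})"
    (is "?L = ?R")
proof (intro equalityI subsetI)
  fix Bs assume Bs: "Bs \<in> ?L"
  then have len: "length Bs = Suc k"
    by (simp add: spanning_chains_def subset_chains_def)
  then obtain As B where eq: "Bs = As @ [B]" and lenA: "length As = k"
    by (metis append_butlast_last_id diff_Suc_1 length_butlast list.size(3) nat.distinct(1))
  have BE: "B \<subseteq> E"
    using Bs eq by (auto simp: spanning_chains_def subset_chains_def)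
  have cl: "closure (Bs ! i) = (Xs @ [X]) ! i" if "i < Suc k" for i
    using Bs that by (auto simp: spanning_chains_def)
  have "closure B = X"
    using cl[of k] assms(1) lenA eq by (simp add: nth_append)
  moreover have "closure (As ! i) = Xs ! i" if "i < k" for i
    using cl[of i] that assms(1) lenA eq by (simp add: nth_append)
  then have "As \<in> spanning_chains k Xs"
    using Bs eq lenA by (auto simp: spanning_chains_def subset_chains_def sorted_wrt_append)
  moreover have "\<Union>(set As) \<subseteq> B"
    using Bs eq by (auto simp: spanning_chains_def subset_chains_def sorted_wrt_append)
  ultimately show "Bs \<in> ?R"
    using closure_eq_flat_iff[OF assms(2) BE] eq by force
next
  fix Bs assume "Bs \<in> ?R"
  then obtain As B where eq: "Bs = As @ [B]" and As: "As \<in> spanning_chains k Xs"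
    and B: "\<Union>(set As) \<subseteq> B" "B \<subseteq> X" "rk B = rk X"
    by auto
  have BE: "B \<subseteq> E"
    using B assms by (auto simp: flats_def)
  have "closure B = X"
    using closure_eq_flat_iff[OF assms(2) BE] B by simp
  then show "Bs \<in> ?L"
    using As B BE eq assms(1)
    by (auto simp: spanning_chains_def subset_chains_def sorted_wrt_append nth_append less_Suc_eq)
qed

text \<open>The factor \<open>g\<close> allows a second use: with \<open>g = 1\<close> the last
  entry is summed out, then with the resulting \<open>spanning_sum\<close> as \<open>g\<close> the
  entry before it.\<close>

lemma sum_spanning_chains_snoc:
  assumes "length Xs = k" and "X \<in> flats"
  shows "(\<Sum>As \<in> spanning_chains (Suc k) (Xs @ [X]). chain_weight As * g As) =
    (\<Sum>As \<in> spanning_chains k Xs. chain_weight As *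
      (\<Sum>B \<in> {B. \<Union>(set As) \<subseteq> B \<and> B \<subseteq> X \<and> rk B = rk X}. (-1) ^ card B * g (As @ [B])))"
proof -
  have fin: "finite (spanning_chains k Xs)"
    using finite_subset_chains by (simp add: spanning_chains_def)
  have "X \<subseteq> E"
    using assms(2) by (simp add: flats_def)
  then have finP: "finite (Pow X)"
    using finite_ground by (simp add: finite_subset)
  have fin': "finite {B. \<Union>(set As) \<subseteq> B \<and> B \<subseteq> X \<and> rk B = rk X}" for As
    by (rule finite_subset[OF _ finP]) auto
  show ?thesis
    unfolding spanning_chains_snoc[OF assms]
    by (subst sum.reindex)
      (auto simp: inj_on_def sum.Sigma[OF fin] fin' sum_distrib_left chain_weight_snoc mult.assoc
        intro!: sum.cong)
qed

lemma chain_mobius_snoc: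
  assumes "length Xs = k" and "X \<in> flats"
  shows "chain_mobius (Suc k) (Xs @ [X]) =
    (\<Sum>As \<in> spanning_chains k Xs. chain_weight As * spanning_sum (\<Union>(set As)) X)"
  using sum_spanning_chains_snoc[OF assms, of "\<lambda>_. 1"]
  by (simp add: chain_mobius_eq spanning_sum_def)

lemma chain_mobius_snoc_snoc:
  assumes len: "length Xs = k" and flat: "set Xs \<subseteq> flats" "Y \<in> flats" "Z \<in> flats"
    and le: "\<And>X. X \<in> set Xs \<Longrightarrow> X \<subseteq> Y" "Y \<subseteq> Z"
  shows "chain_mobius (Suc (Suc k)) (Xs @ [Y, Z]) =
    chain_mobius k Xs * ((-1) ^ card Y * spanning_sum Y Z)"
proof -
  have ZE: "Z \<subseteq> E"
    using flat by (simp add: flats_def)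
  then have finP: "finite (Pow Y)"
    using finite_ground le by (simp add: finite_subset)
  have collapse: "(\<Sum>B \<in> {B. \<Union>(set As) \<subseteq> B \<and> B \<subseteq> Y \<and> rk B = rk Y}.
      (-1) ^ card B * spanning_sum (\<Union>(set (As @ [B]))) Z) = (-1) ^ card Y * spanning_sum Y Z"
    (is "sum ?f ?S = _") if As: "As \<in> spanning_chains k Xs" for As
  proof -
    have AsE: "length As = k" "set As \<subseteq> Pow E" and cl: "\<And>i. i < k \<Longrightarrow> closure (As ! i) = Xs ! i"
      using As by (auto simp: spanning_chains_def subset_chains_def)
    have "As ! i \<subseteq> Y" if "i < k" for i
    proof -
      have "As ! i \<subseteq> Xs ! i"
        using closure_superset[of "As ! i"] cl[OF that] AsE that by (auto dest: nth_mem)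
      also have "\<dots> \<subseteq> Y"
        using le len that by auto
      finally show ?thesis .
    qed
    then have sub: "\<Union>(set As) \<subseteq> Y"
      using AsE by (force simp: in_set_conv_nth)
    have finS: "finite ?S"
      by (rule finite_subset[OF _ finP]) auto
    \<comment> \<open>Since \<open>B\<close> already has the rank of \<open>Y\<close>, any
      \<open>e\<close> in \<open>Y - B\<close> is a loop of the contraction of \<open>Z\<close> by
      \<open>B\<close>.\<close>
    have "?f B = 0" if B: "B \<in> ?S - {Y}" for B
    proof -
      obtain e where e: "e \<in> Y" "e \<notin> B"
        using B by blast
      have "rk (insert e B) \<le> rk Y"
        using B e le(2) ZE by (intro rk_mono) auto
      moreover have "rk B \<le> rk (insert e B)"
        using B e le(2) ZE by (intro rk_mono) auto
      ultimately have "spanning_sum B Z = 0"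
        using B e le(2) ZE by (intro spanning_sum_eq_0[of Z e]) auto
      moreover have "\<Union>(set (As @ [B])) = B"
        using B by auto
      ultimately show ?thesis
        by simp
    qed
    \<comment> \<open>Only \<open>B = Y\<close> survives; it is admissible because each entry of
      \<open>As\<close> lies in its closure and so in \<open>Y\<close>. The result no longer depends
      on \<open>As\<close>.\<close>
    then have "sum ?f ?S = sum ?f {Y}"
      using sub by (intro sum.mono_neutral_right[OF finS]) auto
    moreover have "\<Union>(set (As @ [Y])) = Y"
      using sub by auto
    ultimately show ?thesis
      by simp
  qed
  have "chain_mobius (Suc (Suc k)) ((Xs @ [Y]) @ [Z]) =
      (\<Sum>As \<in> spanning_chains (Suc k) (Xs @ [Y]). chain_weight As * spanning_sum (\<Union>(set As)) Z)"
    using len flat by (intro chain_mobius_snoc) auto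
  also have "\<dots> = (\<Sum>As \<in> spanning_chains k Xs. chain_weight As * ((-1) ^ card Y * spanning_sum Y Z))"
    unfolding sum_spanning_chains_snoc[OF len flat(2)]
    by (intro sum.cong refl arg_cong2[where f = "(*)"] collapse)
  also have "\<dots> = chain_mobius k Xs * ((-1) ^ card Y * spanning_sum Y Z)"
    by (simp add: chain_mobius_eq sum_distrib_right)
  finally show ?thesis
    by simp
qed

section \<open>Base cases and the sign of the chain Mobius function\<close>

lemma chain_mobius_0: "chain_mobius 0 [] = 1"
proof -
  have "spanning_chains 0 [] = {[]}"
    by (auto simp: spanning_chains_def subset_chains_def)
  then show ?thesis
    by (simp add: chain_mobius_eq chain_weight_def)
qed

lemma chain_mobius_1:
  assumes "X \<in> flats"
  shows "chain_mobius (Suc 0) [X] = spanning_sum {} X"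
proof -
  have "spanning_chains 0 [] = {[]}"
    by (auto simp: spanning_chains_def subset_chains_def)
  then show ?thesis
    using chain_mobius_snoc[of "[]" 0 X] assms by (simp add: chain_weight_def)
qed

text \<open>Steps of two require both base cases; even \<open>k\<close> descend to the empty chain,
  so \<open>k = 0\<close> is included.\<close>

lemma sgn_chain_mobius:
  assumes "\<And>e. \<not> loop e" and "Xs \<in> flat_chains k"
  shows "sgn (chain_mobius k Xs) = (\<Prod>i<k. (-1) ^ rk (Xs ! i))"
  using assms(2)
proof (induction k arbitrary: Xs rule: less_induct)
  case (less k)
  have len: "length Xs = k" and flat: "set Xs \<subseteq> flats" and sorted: "sorted_wrt (\<subseteq>) Xs"
    using less.prems by (auto simp: flat_chains_def)
  consider "k = 0" | "k = Suc 0" | n where "k = Suc (Suc n)"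
    by (metis not0_implies_Suc)
  then show ?case
  proof cases
    case 1
    with len show ?thesis
      by (simp add: chain_mobius_0)
  next
    case 2
    then obtain X where Xs: "Xs = [X]"
      using len by (auto simp: length_Suc_conv)
    \<comment> \<open>Absence of loops enters here: it makes \<open>{}\<close> a flat, so the single
      sum is the case \<open>Y = {}\<close>.\<close>
    have "{} \<in> flats"
      using assms(1) by (auto simp: flats_def rk_empty loop_def)
    then show ?thesis
      using sgn_spanning_sum_flat[of "{}" X] flat 2 Xs by (simp add: chain_mobius_1 rk_empty)
  next
    case (3 n)
    obtain Ws Z where W: "Xs = Ws @ [Z]" "length Ws = Suc n"
      using len 3 by (metis length_Suc_conv_rev)
    then obtain Ys Y where Y: "Ws = Ys @ [Y]" "length Ys = n"
      by (metis length_Suc_conv_rev)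
    have Xs: "Xs = Ys @ [Y, Z]"
      using W Y by simp
    have fl: "set Ys \<subseteq> flats" "Y \<in> flats" "Z \<in> flats" "Y \<subseteq> Z"
      using flat sorted Xs by (auto simp: sorted_wrt_append)
    have "chain_mobius k Xs = chain_mobius n Ys * ((-1) ^ card Y * spanning_sum Y Z)"
      unfolding 3 Xs using Y(2) fl sorted Xs
      by (intro chain_mobius_snoc_snoc) (auto simp: sorted_wrt_append)
    moreover have "Ys \<in> flat_chains n"
      using fl sorted Xs Y by (auto simp: flat_chains_def sorted_wrt_append)
    then have "sgn (chain_mobius n Ys) = (\<Prod>i<n. (-1) ^ rk (Ys ! i))"
      using less.IH 3 by simp
    moreover have "(\<Prod>i<n. (-1) ^ rk (Ys ! i)) = (\<Prod>i<n. (-1 :: int) ^ rk (Xs ! i))"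
      using Xs Y(2) by (simp add: nth_append)
    \<comment> \<open>The explicit factor \<open>(-1) ^ card Y\<close> cancels the one in the sign
      of \<open>spanning_sum Y Z\<close>, leaving the two new rank signs.\<close>
    moreover have "sgn ((-1) ^ card Y * spanning_sum Y Z) = (-1) ^ rk Y * (-1) ^ rk Z"
      using sgn_spanning_sum_flat[OF fl(2-4)]
      by (simp add: sgn_mult sgn_minus_one_power uminus_power_if)
    moreover have "Xs ! n = Y" "Xs ! Suc n = Z"
      using Xs Y(2) by (simp_all add: nth_append)
    ultimately show ?thesis
      using 3 by (simp add: sgn_mult mult.assoc)
  qed
qed

end

theorem theorem2p8:
  fixes E :: "'a set" and rk :: "'a set \<Rightarrow> nat" and k :: nat and Xs :: "'a set list"
  assumes "simple_matroid E rk"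
    and "k \<ge> 1"
    and "Xs \<in> matroid.flat_chains E rk k"
  shows "sgn (matroid.chain_mobius E rk k Xs) = (\<Prod>i<k. (-1) ^ rk (Xs ! i))"
proof -
  interpret simple_matroid E rk
    by (rule assms(1))
  show ?thesis
    using no_loops assms(3) by (rule sgn_chain_mobius)
qed

end
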